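(* Let $(R_k)_{k\in\mathbb{N}}$ be a sequence of rectangles in $\mathbb{R}^2$ (of arbitrary orientations) centered at the origin, whose diameters tend to $0$ as $k\to\infty$. Assume that there exists $\alpha>0$ such that for all $k\in\mathbb{N}$ and all $l\in\mathbb{N}$ satisfying $l>k$, one has $$R_k-R_l\subseteq \alpha R_k .$$ Then the Lebesgue differentiation process $(T_k)_{k\in\mathbb{N}}$ associated to $(R_k)_{k\in\mathbb{N}}$ is $L^1$-good.
   Context: Rectangles are solid, closed and non-degenerate (both side-lengths positive), and need not be parallel to the coordinate axes. $|E|$ denotes the Lebesgue measure of $E\subseteq\mathbb{R}^2$. For sets $E,F\subseteq\mathbb{R}^2$, $E-F:=\{x-y: x\in E,\ y\in F\}$ is the set of differences, and $\alpha E:=\{\alpha x: x\in E\}$. The Lebesgue differentiation process associated to $(R_k)$ is the sequence of operators defined for locally integrable $f$ on $\mathbb{R}^2$ by $$T_kf(x):=\frac{1}{|R_k|}\int_{x+R_k} f .$$ Its maximal operator is $T^*f(x):=\sup_{k\in\mathbb{N}}|T_kf(x)|$. The process is called $L^1$-good if $T^*$ has weak type $(1,1)$, i.e. if there is a constant $C>0$ such that for all $f\in L^1(\mathbb{R}^2)$ and all $\lambda>0$, $|\{x\in\mathbb{R}^2: T^*f(x)>\lambda\}|\leq \frac{C}{\lambda}\|f\|_1$. *)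

theory Defs
  imports "HOL-Analysis.Analysis"
begin

definition rectangle_centered_at :: "real^2 \<Rightarrow> (real^2) set \<Rightarrow> bool" where
  "rectangle_centered_at c R \<longleftrightarrow>
     (\<exists>u v a b. norm u = 1 \<and> norm v = 1 \<and> u \<bullet> v = 0 \<and> 0 < a \<and> 0 < b \<and>
        R = {c + s *\<^sub>R u + t *\<^sub>R v | s t. \<bar>s\<bar> \<le> a \<and> \<bar>t\<bar> \<le> b})"

text \<open>Difference of sets in the Minkowski sense (not the set-theoretic difference).\<close>

definition difference_set :: "(real^2) set \<Rightarrow> (real^2) set \<Rightarrow> (real^2) set" where
  "difference_set E F = {x - y | x y. x \<in> E \<and> y \<in> F}"

definition diff_process ::
  "(nat \<Rightarrow> (real^2) set) \<Rightarrow> nat \<Rightarrow> (real^2 \<Rightarrow> real) \<Rightarrow> real^2 \<Rightarrow> real" where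
  "diff_process R k f x =
     (1 / measure lebesgue (R k)) * (LINT y:((+) x ` R k)|lebesgue. f y)"

text \<open>The supremum may be infinite, hence the extended nonnegative values.\<close>

definition maximal_operator ::
  "(nat \<Rightarrow> (real^2 \<Rightarrow> real) \<Rightarrow> real^2 \<Rightarrow> real) \<Rightarrow> (real^2 \<Rightarrow> real) \<Rightarrow> real^2 \<Rightarrow> ennreal" where
  "maximal_operator T f x = (SUP k. ennreal \<bar>T k f x\<bar>)"

text \<open>Measurability of the superlevel sets is explicit because \<^const>\<open>emeasure\<close> is \<open>0\<close>
  on non-measurable sets.\<close>

definition weak_type_1_1 :: "((real^2 \<Rightarrow> real) \<Rightarrow> real^2 \<Rightarrow> ennreal) \<Rightarrow> bool" where
  "weak_type_1_1 S \<longleftrightarrow>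
     (\<exists>C::real. C > 0 \<and>
       (\<forall>f. integrable lebesgue f \<longrightarrow>
         (\<forall>t::real. t > 0 \<longrightarrow>
            {x. S f x > ennreal t} \<in> sets lebesgue \<and>
            emeasure lebesgue {x. S f x > ennreal t}
              \<le> ennreal (C / t * (LINT x|lebesgue. \<bar>f x\<bar>)))))"

definition L1_good :: "(nat \<Rightarrow> (real^2 \<Rightarrow> real) \<Rightarrow> real^2 \<Rightarrow> real) \<Rightarrow> bool" where
  "L1_good T \<longleftrightarrow> weak_type_1_1 (maximal_operator T)"

end

theory Submission
  imports Defs
begin

text \<open>
  The theorem is an instance of Vitali's covering argument. Let \<open>A k\<close> be the set of points \<open>x\<close> at
  which the average of \<open>f\<close> over \<open>x + R k\<close> exceeds \<open>t\<close> in modulus. Among all translates \<open>x + R k\<close>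
  with \<open>x \<in> A k\<close>, select a disjoint subfamily greedily, smaller indices first
  (\<open>ranked_greedy_selection\<close>). The index takes over the role that the radius has in Vitali's lemma:
  any \<open>x + R k\<close> meets a selected \<open>y + R j\<close> with \<open>j \<le> k\<close>, so \<open>x - y\<close> lies in \<open>R j - R k\<close> and hence
  in a fixed dilate \<open>\<beta> R j\<close>. For \<open>j < k\<close> this is the hypothesis on the sequence; for \<open>j = k\<close> it holds
  with factor \<open>2\<close> because rectangles are convex and symmetric.

  Consequently the dilates \<open>y + \<beta> R j\<close> of the selected translates cover the superlevel set of the
  maximal function, at the cost of a factor \<open>\<beta>\<^sup>2\<close> in measure, while disjointness bounds the total
  measure of the selected translates by \<open>\<parallel>f\<parallel>\<^sub>1 / t\<close> (\<open>covering_measure_bound\<close>,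
  \<open>maximal_average_weak_bound\<close>). Measurability of the superlevel set comes from the continuity of
  \<open>x \<mapsto> \<integral>\<^bsub>x + R k\<^esub> f\<close>, which makes it open (\<open>continuous_on_integral_translate\<close>).
\<close>

section \<open>Greedy selection\<close>

text \<open>
  Well-order the index type, break ties of \<open>rank\<close> by that order, and run through the indices by
  well-founded recursion, selecting an index if it conflicts with none selected before. A rejected
  index then conflicts with an earlier one, whose rank cannot be larger. Letting the recursion be
  transfinite avoids having to show that only finitely many indices of each rank get selected.
\<close>

lemma ranked_greedy_selection:
  fixes rank :: "'i \<Rightarrow> nat" and conflict :: "'i \<Rightarrow> 'i \<Rightarrow> bool"
  assumes refl: "\<And>i. i \<in> I \<Longrightarrow> conflict i i"
    and sym: "\<And>i j. conflict i j \<Longrightarrow> conflict j i"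
  obtains S where "S \<subseteq> I"
    and "\<And>i j. i \<in> S \<Longrightarrow> j \<in> S \<Longrightarrow> i \<noteq> j \<Longrightarrow> \<not> conflict i j"
    and "\<And>i. i \<in> I \<Longrightarrow> \<exists>j\<in>S. rank j \<le> rank i \<and> conflict j i"
proof -
  obtain r :: "'i rel" where r: "well_order_on UNIV r"
    using well_ordering by metis
  define before where
    "before = inv_image (less_than <*lex*> (r - Id)) (\<lambda>i. (rank i, i))"
  have before_iff: "(j, i) \<in> before \<longleftrightarrow>
      rank j < rank i \<or> rank j = rank i \<and> (j, i) \<in> r \<and> j \<noteq> i" for i j
    by (auto simp: before_def)
  have wf: "wf before"
    using r unfolding before_def well_order_on_def
    by (intro wf_inv_image wf_lex_prod) auto
  have total: "(i, j) \<in> before \<or> (j, i) \<in> before" if "i \<noteq> j" for i j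
    using r that unfolding before_iff well_order_on_def linear_order_on_def total_on_def
    by (metis UNIV_I linorder_neqE_nat)
  define chosen where
    "chosen = wfrec before (\<lambda>g i. i \<in> I \<and> (\<forall>j. (j, i) \<in> before \<longrightarrow> g j \<longrightarrow> \<not> conflict j i))"
  have chosen_iff: "chosen i \<longleftrightarrow>
      i \<in> I \<and> (\<forall>j. (j, i) \<in> before \<longrightarrow> chosen j \<longrightarrow> \<not> conflict j i)" for i
    unfolding chosen_def by (subst wfrec[OF wf]) (auto simp: cut_apply)
  show thesis
  proof
    show "{i. chosen i} \<subseteq> I"
      using chosen_iff by blast
    show "\<not> conflict i j" if "i \<in> {i. chosen i}" "j \<in> {i. chosen i}" "i \<noteq> j" for i j
      using that total[of i j] chosen_iff sym by (metis mem_Collect_eq)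
    show "\<exists>j\<in>{i. chosen i}. rank j \<le> rank i \<and> conflict j i" if "i \<in> I" for i
    proof (cases "chosen i")
      case True
      with refl[OF that] show ?thesis
        by (intro bexI[of _ i]) simp_all
    next
      case False
      then obtain j where "(j, i) \<in> before" "chosen j" "conflict j i"
        using \<open>i \<in> I\<close> chosen_iff[of i] by blast
      then show ?thesis
        unfolding before_iff by (auto intro: less_imp_le)
    qed
  qed
qed

section \<open>The covering bound\<close>

text \<open>
  This lets countable additivity be used on the selected family: disjoint sets with nonempty
  interior are at most countably many in a second countable space.
\<close>

lemma countable_disjoint_translates:
  fixes K :: "nat \<Rightarrow> ('a::euclidean_space) set"
  assumes int: "\<And>k. interior (K k) \<noteq> {}"
    and disj: "\<And>p q. p \<in> S \<Longrightarrow> q \<in> S \<Longrightarrow> p \<noteq> q \<Longrightarrow>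
      (+) (fst p) ` K (snd p) \<inter> (+) (fst q) ` K (snd q) = {}"
  shows "countable S"
proof -
  define U where "U p = interior ((+) (fst p) ` K (snd p))" for p
  have U_ne: "U p \<noteq> {}" for p
    using int by (simp add: U_def interior_translation)
  have U_disj: "U p \<inter> U q = {}" if "p \<in> S" "q \<in> S" "p \<noteq> q" for p q
  proof -
    have "U p \<subseteq> (+) (fst p) ` K (snd p)" "U q \<subseteq> (+) (fst q) ` K (snd q)"
      unfolding U_def by (rule interior_subset)+
    with disj[OF that] show ?thesis by blast
  qed
  have "countable (U ` S)"
  proof (rule countable_disjoint_open_subsets)
    show "open V" if "V \<in> U ` S" for V
      using that by (auto simp: U_def)
    show "pairwise disjnt (U ` S)"
      unfolding pairwise_def disjnt_def using U_disj by blast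
  qed
  moreover have "inj_on U S"
  proof (rule inj_onI, rule ccontr)
    fix p q assume "p \<in> S" "q \<in> S" "U p = U q" "p \<noteq> q"
    with U_disj[of p q] U_ne[of q] show False by simp
  qed
  ultimately show ?thesis
    by (rule countable_image_inj_on)
qed

text \<open>
  The covering argument, separated from the function being averaged: \<open>\<nu>\<close> stands for
  \<open>\<bar>f\<bar> / t\<close> times Lebesgue measure. With \<open>S\<close> the selected centre-index pairs, \<open>Q p\<close> the corresponding
  translates and \<open>D p\<close> their dilates,
  \<open>\<bar>\<Union>k. A k\<bar> \<le> \<Sum>\<^sub>p \<bar>D p\<bar> \<le> \<bar>\<beta>\<bar>\<^sup>d \<Sum>\<^sub>p \<nu> (Q p) \<le> \<bar>\<beta>\<bar>\<^sup>d \<nu> UNIV\<close>, where \<open>d\<close> is the dimension.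
\<close>

proposition covering_measure_bound:
  fixes K A :: "nat \<Rightarrow> ('a::euclidean_space) set"
  assumes cpt: "\<And>k. compact (K k)" and int: "\<And>k. interior (K k) \<noteq> {}"
    and diff: "\<And>k l x y. k \<le> l \<Longrightarrow> x \<in> K k \<Longrightarrow> y \<in> K l \<Longrightarrow> x - y \<in> (*\<^sub>R) \<beta> ` K k"
    and sets_\<nu>: "sets \<nu> = sets lebesgue"
    and dens: "\<And>k x. x \<in> A k \<Longrightarrow> emeasure lebesgue (K k) \<le> emeasure \<nu> ((+) x ` K k)"
  shows "emeasure lebesgue (\<Union>k. A k) \<le> ennreal (\<bar>\<beta>\<bar> ^ DIM('a)) * emeasure \<nu> UNIV"
proof -
  define Q where "Q p = (+) (fst p) ` K (snd p)" for p
  define D where "D p = (\<lambda>z. \<beta> *\<^sub>R z + fst p) ` K (snd p)" for p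
  have K_ne: "K k \<noteq> {}" for k
    using int[of k] by auto
  have self: "Q p \<inter> Q p \<noteq> {}" for p
    using K_ne by (simp add: Q_def)
  have sym: "Q q \<inter> Q p \<noteq> {}" if "Q p \<inter> Q q \<noteq> {}" for p q
    using that by blast
  obtain S where S_sub: "S \<subseteq> {(x, k). x \<in> A k}"
    and S_disj: "\<And>p q. p \<in> S \<Longrightarrow> q \<in> S \<Longrightarrow> p \<noteq> q \<Longrightarrow> \<not> Q p \<inter> Q q \<noteq> {}"
    and S_meet: "\<And>p. p \<in> {(x, k). x \<in> A k} \<Longrightarrow> \<exists>q\<in>S. snd q \<le> snd p \<and> Q q \<inter> Q p \<noteq> {}"
    by (rule ranked_greedy_selection[where I = "{(x, k). x \<in> A k}" and rank = snd
          and conflict = "\<lambda>p q. Q p \<inter> Q q \<noteq> {}", OF self sym]) (assumption, rule that)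
  have "countable S"
  proof (rule countable_disjoint_translates[OF int])
    fix p q assume "p \<in> S" "q \<in> S" "p \<noteq> q"
    then show "(+) (fst p) ` K (snd p) \<inter> (+) (fst q) ` K (snd q) = {}"
      using S_disj unfolding Q_def by blast
  qed
  have cover: "(\<Union>k. A k) \<subseteq> (\<Union>q\<in>S. D q)"
  proof
    fix x assume "x \<in> (\<Union>k. A k)"
    then obtain k where "x \<in> A k" by blast
    then obtain q where q: "q \<in> S" "snd q \<le> k" and meet: "Q q \<inter> Q (x, k) \<noteq> {}"
      using S_meet[of "(x, k)"] by force
    then obtain a b where ab: "a \<in> K (snd q)" "b \<in> K k" "fst q + a = x + b"
      by (auto simp: Q_def)
    then obtain c where "c \<in> K (snd q)" "a - b = \<beta> *\<^sub>R c"
      using diff[OF q(2)] by blast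
    with ab(3) have "x = \<beta> *\<^sub>R c + fst q"
      by (simp add: algebra_simps)
    with \<open>c \<in> K (snd q)\<close> q(1) show "x \<in> (\<Union>q\<in>S. D q)"
      unfolding D_def by blast
  qed
  have Q_sets: "Q p \<in> sets lebesgue" for p
    unfolding Q_def by (metis cpt compact_translation lmeasurable_compact fmeasurableD)
  have D_sets: "D p \<in> sets lebesgue" for p
  proof -
    have "compact (D p)"
      unfolding D_def by (intro compact_continuous_image cpt continuous_intros)
    then show ?thesis
      by (metis lmeasurable_compact fmeasurableD)
  qed
  have D_le: "emeasure lebesgue (D p) \<le> ennreal (\<bar>\<beta>\<bar> ^ DIM('a)) * emeasure \<nu> (Q p)"
    if "p \<in> S" for p
  proof -
    have "emeasure lebesgue (D p) = ennreal (\<bar>\<beta>\<bar> ^ DIM('a)) * emeasure lebesgue (K (snd p))"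
      unfolding D_def using emeasure_lebesgue_affine[of \<beta> "fst p" "K (snd p)"] by simp
    also have "\<dots> \<le> ennreal (\<bar>\<beta>\<bar> ^ DIM('a)) * emeasure \<nu> (Q p)"
      using S_sub that dens[of "fst p" "snd p"] by (intro mult_left_mono) (auto simp: Q_def)
    finally show ?thesis .
  qed
  \<comment> \<open>Reindex both families by the natural numbers, with empty sets as padding, so that a finite
    and an infinite selection are treated alike.\<close>
  define X where "X n = (if n \<in> to_nat_on S ` S then Q (from_nat_into S n) else {})" for n
  define Y where "Y n = (if n \<in> to_nat_on S ` S then D (from_nat_into S n) else {})" for n
  have X_sets: "X n \<in> sets lebesgue" and Y_sets: "Y n \<in> sets lebesgue" for n
    by (simp_all add: X_def Y_def Q_sets D_sets)
  have "emeasure lebesgue (\<Union>k. A k) \<le> emeasure lebesgue (\<Union>n. Y n)"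
  proof (rule emeasure_mono)
    have "(\<Union>q\<in>S. D q) \<subseteq> (\<Union>n. Y n)"
    proof
      fix x assume "x \<in> (\<Union>q\<in>S. D q)"
      then obtain q where "q \<in> S" "x \<in> D q" by blast
      then have "x \<in> Y (to_nat_on S q)"
        using \<open>countable S\<close> by (simp add: Y_def)
      then show "x \<in> (\<Union>n. Y n)" by blast
    qed
    with cover show "(\<Union>k. A k) \<subseteq> (\<Union>n. Y n)" by blast
    show "(\<Union>n. Y n) \<in> sets lebesgue"
      by (intro sets.countable_UN image_subsetI Y_sets)
  qed
  also have "\<dots> \<le> (\<Sum>n. emeasure lebesgue (Y n))"
    by (intro emeasure_subadditive_countably image_subsetI Y_sets)
  also have "\<dots> \<le> (\<Sum>n. ennreal (\<bar>\<beta>\<bar> ^ DIM('a)) * emeasure \<nu> (X n))"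
  proof (intro suminf_le summableI)
    fix n
    show "emeasure lebesgue (Y n) \<le> ennreal (\<bar>\<beta>\<bar> ^ DIM('a)) * emeasure \<nu> (X n)"
      using D_le \<open>countable S\<close> by (cases "n \<in> to_nat_on S ` S") (auto simp: X_def Y_def)
  qed
  also have "\<dots> = ennreal (\<bar>\<beta>\<bar> ^ DIM('a)) * (\<Sum>n. emeasure \<nu> (X n))"
    by simp
  also have "(\<Sum>n. emeasure \<nu> (X n)) = emeasure \<nu> (\<Union>n. X n)"
  proof (rule suminf_emeasure)
    show "range X \<subseteq> sets \<nu>"
      unfolding sets_\<nu> by (intro image_subsetI X_sets)
    show "disjoint_family X"
    proof (unfold disjoint_family_on_def, intro ballI impI)
      fix m n :: nat assume "m \<noteq> n"
      show "X m \<inter> X n = {}"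
      proof (cases "m \<in> to_nat_on S ` S \<and> n \<in> to_nat_on S ` S")
        case True
        then obtain p q where pq: "p \<in> S" "q \<in> S" "m = to_nat_on S p" "n = to_nat_on S q"
          by blast
        with \<open>m \<noteq> n\<close> have "Q p \<inter> Q q = {}"
          using S_disj by blast
        with pq \<open>countable S\<close> show ?thesis
          by (simp add: X_def)
      qed (auto simp: X_def)
    qed
  qed
  also have "ennreal (\<bar>\<beta>\<bar> ^ DIM('a)) * emeasure \<nu> (\<Union>n. X n)
      \<le> ennreal (\<bar>\<beta>\<bar> ^ DIM('a)) * emeasure \<nu> UNIV"
    by (intro mult_left_mono emeasure_mono) (simp_all add: sets_\<nu>)
  finally show ?thesis .
qed

section \<open>Averages over translates\<close>

text \<open>
  If \<open>u n\<close> tends to \<open>x\<close>, then the indicators of \<open>u n + K\<close> tend to that of \<open>x + K\<close> at every point off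
  the null set \<open>x + frontier K\<close>, and dominated convergence applies with \<open>\<bar>f\<bar>\<close> as majorant.
\<close>

lemma continuous_on_integral_translate:
  fixes f :: "'a::euclidean_space \<Rightarrow> real"
  assumes cpt: "compact K" and front: "negligible (frontier K)"
    and f: "integrable lebesgue f"
  shows "continuous_on UNIV (\<lambda>x. LINT y:(+) x ` K|lebesgue. f y)"
proof (rule continuous_at_imp_continuous_on, rule ballI, rule continuous_at_sequentiallyI)
  fix x :: 'a and u :: "nat \<Rightarrow> 'a"
  assume u: "u \<longlonglongrightarrow> x"
  have mem: "y \<in> (+) z ` K \<longleftrightarrow> y - z \<in> K" for y z
    by (auto simp: image_iff algebra_simps intro: bexI[of _ "y - z"])
  have K_sets: "(+) z ` K \<in> sets lebesgue" for z
    by (metis cpt compact_translation lmeasurable_compact fmeasurableD)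
  have f_meas[measurable]: "f \<in> borel_measurable lebesgue"
    using f by auto
  show "(\<lambda>n. LINT y:(+) (u n) ` K|lebesgue. f y) \<longlonglongrightarrow> (LINT y:(+) x ` K|lebesgue. f y)"
    unfolding set_lebesgue_integral_def
  proof (rule integral_dominated_convergence)
    show "integrable lebesgue (\<lambda>y. \<bar>f y\<bar>)"
      using f by simp
    show "(\<lambda>y. indicat_real ((+) x ` K) y *\<^sub>R f y) \<in> borel_measurable lebesgue"
      using K_sets by (intro borel_measurable_scaleR borel_measurable_indicator) auto
    show "(\<lambda>y. indicat_real ((+) (u n) ` K) y *\<^sub>R f y) \<in> borel_measurable lebesgue" for n
      using K_sets by (intro borel_measurable_scaleR borel_measurable_indicator) auto
    show "AE y in lebesgue. norm (indicat_real ((+) (u n) ` K) y *\<^sub>R f y) \<le> \<bar>f y\<bar>" for n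
      by (auto split: split_indicator)
    have "(+) x ` frontier K \<in> null_sets lebesgue"
      using front by (simp add: negligible_translation flip: negligible_iff_null_sets)
    then have "AE y in lebesgue. y \<notin> (+) x ` frontier K"
      by (rule AE_not_in)
    then show "AE y in lebesgue. (\<lambda>n. indicat_real ((+) (u n) ` K) y *\<^sub>R f y)
        \<longlonglongrightarrow> indicat_real ((+) x ` K) y *\<^sub>R f y"
    proof (rule eventually_mono)
      fix y assume y: "y \<notin> (+) x ` frontier K"
      \<comment> \<open>Off the frontier, \<open>y - x\<close> has a neighbourhood inside or outside \<open>K\<close>, which eventually
        contains \<open>y - u n\<close>.\<close>
      have lim: "(\<lambda>n. y - u n) \<longlonglongrightarrow> y - x"
        by (intro tendsto_intros u)
      have "y - x \<notin> frontier K"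
        using y by (metis add.commute diff_add_cancel image_eqI)
      then consider "y - x \<in> interior K" | "y - x \<in> - K"
        using cpt by (auto simp: frontier_def compact_imp_closed closure_closed)
      then have "eventually (\<lambda>n. y - u n \<in> K \<longleftrightarrow> y - x \<in> K) sequentially"
      proof cases
        case 1
        then show ?thesis
          using topological_tendstoD[OF lim open_interior 1] interior_subset
          by (auto elim!: eventually_mono)
      next
        case 2
        then show ?thesis
          using topological_tendstoD[OF lim _ 2] cpt
          by (auto elim!: eventually_mono simp: compact_imp_closed open_Compl)
      qed
      then show "(\<lambda>n. indicat_real ((+) (u n) ` K) y *\<^sub>R f y)
          \<longlonglongrightarrow> indicat_real ((+) x ` K) y *\<^sub>R f y"
        by (intro tendsto_eventually) (auto elim!: eventually_mono simp: indicator_def mem)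
    qed
  qed
qed

text \<open>
  The set on the left is the superlevel set of the maximal function, with the averages cleared of
  their denominators.
\<close>

proposition maximal_average_weak_bound:
  fixes K :: "nat \<Rightarrow> ('a::euclidean_space) set" and f :: "'a \<Rightarrow> real"
  assumes cpt: "\<And>k. compact (K k)" and int: "\<And>k. interior (K k) \<noteq> {}"
    and diff: "\<And>k l x y. k \<le> l \<Longrightarrow> x \<in> K k \<Longrightarrow> y \<in> K l \<Longrightarrow> x - y \<in> (*\<^sub>R) \<beta> ` K k"
    and f: "integrable lebesgue f" and t: "t > 0"
  shows "emeasure lebesgue
      (\<Union>k. {x. t * measure lebesgue (K k) < \<bar>LINT y:(+) x ` K k|lebesgue. f y\<bar>})
    \<le> ennreal (\<bar>\<beta>\<bar> ^ DIM('a) / t * (LINT x|lebesgue. \<bar>f x\<bar>))"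
proof -
  define \<nu> where "\<nu> = density lebesgue (\<lambda>x. ennreal (\<bar>f x\<bar> / t))"
  have f_meas[measurable]: "f \<in> borel_measurable lebesgue"
    using f by auto
  have \<nu>_eq: "emeasure \<nu> B = ennreal ((LINT y:B|lebesgue. \<bar>f y\<bar>) / t)"
    if B: "B \<in> sets lebesgue" for B
  proof -
    have "integrable lebesgue (\<lambda>y. indicat_real B y *\<^sub>R \<bar>f y\<bar>)"
      using B f by (intro integrable_mult_indicator) auto
    then have int: "integrable lebesgue (\<lambda>y. indicat_real B y *\<^sub>R \<bar>f y\<bar> / t)"
      by (rule integrable_divide_zero)
    have "emeasure \<nu> B = (\<integral>\<^sup>+ y. ennreal (\<bar>f y\<bar> / t) * indicator B y \<partial>lebesgue)"
      unfolding \<nu>_def using B by (intro emeasure_density) auto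
    also have "\<dots> = (\<integral>\<^sup>+ y. ennreal (indicat_real B y *\<^sub>R \<bar>f y\<bar> / t) \<partial>lebesgue)"
      by (intro nn_integral_cong) (auto split: split_indicator)
    also have "\<dots> = ennreal (LINT y|lebesgue. indicat_real B y *\<^sub>R \<bar>f y\<bar> / t)"
      using int t by (intro nn_integral_eq_integral) auto
    also have "\<dots> = ennreal ((LINT y:B|lebesgue. \<bar>f y\<bar>) / t)"
      by (simp add: set_lebesgue_integral_def)
    finally show ?thesis .
  qed
  have "emeasure lebesgue
      (\<Union>k. {x. t * measure lebesgue (K k) < \<bar>LINT y:(+) x ` K k|lebesgue. f y\<bar>})
    \<le> ennreal (\<bar>\<beta>\<bar> ^ DIM('a)) * emeasure \<nu> UNIV"
  proof (rule covering_measure_bound[OF cpt int diff])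
    show "sets \<nu> = sets lebesgue"
      by (simp add: \<nu>_def)
    fix k x
    assume "x \<in> {x. t * measure lebesgue (K k) < \<bar>LINT y:(+) x ` K k|lebesgue. f y\<bar>}"
    then have large: "t * measure lebesgue (K k) < \<bar>LINT y:(+) x ` K k|lebesgue. f y\<bar>"
      by simp
    have Q: "(+) x ` K k \<in> sets lebesgue"
      by (metis cpt compact_translation lmeasurable_compact fmeasurableD)
    have "set_integrable lebesgue ((+) x ` K k) f"
      unfolding set_integrable_def using Q f by (rule integrable_mult_indicator)
    then have "\<bar>LINT y:(+) x ` K k|lebesgue. f y\<bar> \<le> (LINT y:(+) x ` K k|lebesgue. \<bar>f y\<bar>)"
      using set_integral_norm_bound by fastforce
    with large have "measure lebesgue (K k) \<le> (LINT y:(+) x ` K k|lebesgue. \<bar>f y\<bar>) / t"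
      using t by (simp add: field_simps)
    then have "ennreal (measure lebesgue (K k)) \<le> emeasure \<nu> ((+) x ` K k)"
      unfolding \<nu>_eq[OF Q] by (rule ennreal_leI)
    moreover have "emeasure lebesgue (K k) = ennreal (measure lebesgue (K k))"
      using lmeasurable_compact[OF cpt] by (rule emeasure_eq_measure2)
    ultimately show "emeasure lebesgue (K k) \<le> emeasure \<nu> ((+) x ` K k)"
      by simp
  qed
  also have "\<dots> = ennreal (\<bar>\<beta>\<bar> ^ DIM('a) / t * (LINT x|lebesgue. \<bar>f x\<bar>))"
    using t by (simp add: \<nu>_eq set_lebesgue_integral_def flip: ennreal_mult)
  finally show ?thesis .
qed

section \<open>Rectangles\<close>

text \<open>
  The topological and convexity properties of a box pass to tilted rectangles through the map from
  coordinates in the orthonormal frame to points.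
\<close>

lemma rectangle_as_linear_image:
  assumes "rectangle_centered_at 0 R"
  obtains T :: "real^2 \<Rightarrow> real^2" and w
  where "linear T" "inj T" "\<And>i. 0 < w $ i" "R = T ` cbox (- w) w"
proof -
  obtain u v :: "real^2" and a b where uv: "norm u = 1" "norm v = 1" "u \<bullet> v = 0"
    and ab: "0 < a" "0 < b"
    and R: "R = {0 + s *\<^sub>R u + t *\<^sub>R v | s t. \<bar>s\<bar> \<le> a \<and> \<bar>t\<bar> \<le> b}"
    using assms unfolding rectangle_centered_at_def by blast
  define T where "T p = p $ 1 *\<^sub>R u + p $ 2 *\<^sub>R v" for p :: "real^2"
  show thesis
  proof
    show lin: "linear T"
      by (rule linearI) (simp_all add: T_def algebra_simps)
    have "p = 0" if "T p = 0" for p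
    proof -
      have "T p \<bullet> u = p $ 1" "T p \<bullet> v = p $ 2"
        using uv by (simp_all add: T_def inner_add_left inner_commute[of v u] dot_square_norm)
      then have "p $ 1 = 0" "p $ 2 = 0"
        unfolding that by simp_all
      then show ?thesis
        by (simp add: vec_eq_iff forall_2)
    qed
    then show "inj T"
      by (simp add: linear_injective_0[OF lin])
    have "\<forall>i. 0 < (vector [a, b] :: real^2) $ i"
      using ab by (simp add: forall_2)
    then show "0 < (vector [a, b] :: real^2) $ i" for i
      by blast
    show "R = T ` cbox (- vector [a, b]) (vector [a, b])"
    proof (intro equalityI subsetI)
      fix x assume "x \<in> R"
      then obtain s t where "x = s *\<^sub>R u + t *\<^sub>R v" "\<bar>s\<bar> \<le> a" "\<bar>t\<bar> \<le> b"
        by (auto simp: R)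
      then have "x = T (vector [s, t])" "vector [s, t] \<in> cbox (- vector [a, b]) (vector [a, b] :: real^2)"
        by (auto simp: T_def mem_box_cart forall_2)
      then show "x \<in> T ` cbox (- vector [a, b]) (vector [a, b])"
        by blast
    next
      fix x assume "x \<in> T ` cbox (- vector [a, b]) (vector [a, b])"
      then obtain p where p: "x = T p" "p \<in> cbox (- vector [a, b]) (vector [a, b])"
        by blast
      then have "\<bar>p $ 1\<bar> \<le> a" "\<bar>p $ 2\<bar> \<le> b"
        by (auto simp: mem_box_cart forall_2)
      then show "x \<in> R"
        using p(1) unfolding R T_def by auto
    qed
  qed
qed

lemma rectangle_convex_body:
  assumes "rectangle_centered_at 0 R"
  shows "compact R" "convex R" "uminus ` R \<subseteq> R" "0 \<in> R" "interior R \<noteq> {}"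
proof -
  obtain T :: "real^2 \<Rightarrow> real^2" and w where T: "linear T" "inj T"
    and w: "\<And>i. 0 < w $ i" and R: "R = T ` cbox (- w) w"
    using rectangle_as_linear_image[OF assms] by metis
  show "compact R"
    unfolding R
    by (intro compact_continuous_image linear_continuous_on compact_cbox)
       (simp add: T(1) linear_conv_bounded_linear[symmetric])
  show "convex R"
    unfolding R by (intro convex_linear_image T(1) convex_box)
  have neg: "- p \<in> cbox (- w) w" if "p \<in> cbox (- w) w" for p
    using that by (auto simp: mem_box_cart) (smt (verit))+
  show "uminus ` R \<subseteq> R"
    unfolding R using neg by (auto simp flip: linear_neg[OF T(1)])
  have "0 \<in> cbox (- w) w"
    using w by (simp add: mem_box_cart less_imp_le)
  then show "0 \<in> R"
    unfolding R using linear_0[OF T(1)] by (metis image_eqI)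
  have "interior R = T ` box (- w) w"
    unfolding R using interior_injective_linear_image[OF T] by (simp add: interior_cbox)
  moreover have "0 \<in> box (- w) w"
    using w by (simp add: mem_box_cart)
  ultimately show "interior R \<noteq> {}"
    by blast
qed

lemma convex_dilate_mono:
  fixes K :: "'a::real_vector set"
  assumes "convex K" "0 \<in> K" "0 \<le> c" "c \<le> d"
  shows "(*\<^sub>R) c ` K \<subseteq> (*\<^sub>R) d ` K"
proof (cases "d = 0")
  case True
  with assms show ?thesis by auto
next
  case False
  with assms have d: "d > 0" by auto
  show ?thesis
  proof
    fix x assume "x \<in> (*\<^sub>R) c ` K"
    then obtain y where y: "y \<in> K" "x = c *\<^sub>R y" by blast
    have "(c / d) *\<^sub>R y + (1 - c / d) *\<^sub>R 0 \<in> K"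
      using assms d y(1) by (intro convexD) auto
    moreover have "x = d *\<^sub>R ((c / d) *\<^sub>R y)"
      using y(2) d by simp
    ultimately show "x \<in> (*\<^sub>R) d ` K"
      by (metis add.right_neutral image_eqI scaleR_zero_right)
  qed
qed

lemma symmetric_convex_diff_in_double:
  fixes K :: "'a::real_vector set"
  assumes "convex K" "uminus ` K \<subseteq> K" "x \<in> K" "y \<in> K"
  shows "x - y \<in> (*\<^sub>R) 2 ` K"
proof
  show "x - y = 2 *\<^sub>R ((1/2) *\<^sub>R x + (1/2) *\<^sub>R (- y))"
    by (simp add: scaleR_right_diff_distrib)
  show "(1/2) *\<^sub>R x + (1/2) *\<^sub>R (- y) \<in> K"
    using assms by (intro convexD) auto
qed

section \<open>Weak type of the differentiation process\<close>

theorem theorem2p1: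
  fixes R :: "nat \<Rightarrow> (real^2) set"
  assumes "\<And>k. rectangle_centered_at 0 (R k)"
    and "(\<lambda>k. diameter (R k)) \<longlonglongrightarrow> 0"
    and "\<exists>\<alpha>::real. \<alpha> > 0 \<and>
           (\<forall>k l. l > k \<longrightarrow> difference_set (R k) (R l) \<subseteq> (\<lambda>x. \<alpha> *\<^sub>R x) ` R k)"
  shows "L1_good (diff_process R)"
proof -
  note R = rectangle_convex_body[OF assms(1)]
  obtain \<alpha> :: real where \<alpha>: "\<alpha> > 0"
    and \<alpha>_diff: "\<And>k l. k < l \<Longrightarrow> difference_set (R k) (R l) \<subseteq> (*\<^sub>R) \<alpha> ` R k"
    using assms(3) by blast
  \<comment> \<open>The hypothesis speaks of \<open>k < l\<close> only; two translates of the same rectangle need the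
    factor \<open>2\<close>.\<close>
  define \<beta> where "\<beta> = max \<alpha> 2"
  have diff: "x - y \<in> (*\<^sub>R) \<beta> ` R k" if "k \<le> l" "x \<in> R k" "y \<in> R l" for k l x y
  proof (cases "k = l")
    case True
    then have "x - y \<in> (*\<^sub>R) 2 ` R k"
      using symmetric_convex_diff_in_double[OF R(2,3)] that by simp
    then show ?thesis
      using convex_dilate_mono[OF R(2,4), of 2 \<beta>] by (auto simp: \<beta>_def)
  next
    case False
    then have "x - y \<in> (*\<^sub>R) \<alpha> ` R k"
      using \<alpha>_diff[of k l] that by (fastforce simp: difference_set_def)
    then show ?thesis
      using convex_dilate_mono[OF R(2,4), of \<alpha> \<beta>] \<alpha> by (auto simp: \<beta>_def)
  qed
  have pos: "0 < measure lebesgue (R k)" for k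
    using R(5)[of k] open_not_negligible[of "interior (R k)"] interior_subset
      negligible_iff_measure0[OF lmeasurable_compact[OF R(1)]] negligible_subset
    by (metis open_interior zero_less_measure_iff)
  have superlevel: "{x. maximal_operator (diff_process R) f x > ennreal t} =
      (\<Union>k. {x. t * measure lebesgue (R k) < \<bar>LINT y:(+) x ` R k|lebesgue. f y\<bar>})"
    if "t > 0" for f t
  proof -
    have "ennreal t < maximal_operator (diff_process R) f x \<longleftrightarrow>
        (\<exists>k. t * measure lebesgue (R k) < \<bar>LINT y:(+) x ` R k|lebesgue. f y\<bar>)" for x
      using that pos
      by (simp add: maximal_operator_def diff_process_def less_SUP_iff ennreal_less_iff
          abs_mult pos_less_divide_eq)
    then show ?thesis by auto
  qed
  show ?thesis
    unfolding L1_good_def weak_type_1_1_def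
  proof (intro exI[of _ "\<beta>\<^sup>2"] conjI allI impI)
    show "0 < \<beta>\<^sup>2"
      by (simp add: \<beta>_def)
    fix f :: "real^2 \<Rightarrow> real" and t :: real
    assume f: "integrable lebesgue f" and t: "t > 0"
    have "open {x. t * measure lebesgue (R k) < \<bar>LINT y:(+) x ` R k|lebesgue. f y\<bar>}" for k
      by (intro open_Collect_less continuous_intros continuous_on_integral_translate
          R(1) negligible_convex_frontier R(2) f)
    then show "{x. maximal_operator (diff_process R) f x > ennreal t} \<in> sets lebesgue"
      unfolding superlevel[OF t] by (auto intro: borel_open)
    show "emeasure lebesgue {x. maximal_operator (diff_process R) f x > ennreal t}
        \<le> ennreal (\<beta>\<^sup>2 / t * (LINT x|lebesgue. \<bar>f x\<bar>))"
      unfolding superlevel[OF t]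
      using maximal_average_weak_bound[OF R(1,5) diff f t] by simp
  qed
qed

end
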